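(* Let $\omega$ be a weight. Consider the following statements. (1) ($\omega\in\bigcup_{p>1}A_p$) There exist $C,p>1$ such that for all $n\in\mathbb{N}$, $\mathbb{E}(\omega|\mathcal{F}_n)\,\mathbb{E}(\omega^{-\frac{1}{p-1}}|\mathcal{F}_n)^{p-1}\le C$. (2) ($\omega\in\bigcup_{q>1}RH_q$) There exist $C,q>1$ such that for all $n\in\mathbb{N}$, $\mathbb{E}(\omega^q|\mathcal{F}_n)\le C\,\mathbb{E}(\omega|\mathcal{F}_n)^q$. (3) ($\omega\in A_\infty^{log}$) There exists $C>1$ such that for all $n\in\mathbb{N}$, $\mathbb{E}_\omega(\log^+\frac{\omega}{\omega_n}|\mathcal{F}_n)\le C$. (4) ($\omega\in A_\infty^{exp}$) There exists a positive constant $C$ such that for all $n\in\mathbb{N}$, $\mathbb{E}(\omega|\mathcal{F}_n)\le C\exp\mathbb{E}(\log\omega|\mathcal{F}_n)$. Then each of the statements (1), (2), (3), (4) implies $\omega\in A_\infty^*$, i.e. there exists a positive constant $C$ such that for all $n\in\mathbb{N}$, $\mathbb{E}(M_n^*(\omega)|\mathcal{F}_n)\le C\omega_n$.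
   Context: $(\Omega,\mathcal{F},\mu)$ is a complete probability space and $(\mathcal{F}_n)_{n\ge0}$ is an increasing sequence of sub-$\sigma$-fields of $\mathcal{F}$ with $\mathcal{F}=\bigvee_{n\ge0}\mathcal{F}_n$. $\mathbb{N}$ is the set of non-negative integers. $\mathbb{E}(\cdot|\mathcal{F}_n)$ is conditional expectation with respect to $\mu$ (of nonnegative functions it may take the value $+\infty$). Relations between random variables hold almost surely. A weight $\omega$ is a random variable with $\omega>0$ and $\mathbb{E}(\omega)<\infty$; $\omega_n:=\mathbb{E}(\omega|\mathcal{F}_n)$. $\mathbb{E}_\omega(\cdot|\mathcal{F}_n)$ is the conditional expectation with respect to $\omega\,d\mu$, i.e. $\mathbb{E}_\omega(f|\mathcal{F}_n)=\mathbb{E}(f\omega|\mathcal{F}_n)/\omega_n$. $\log^+x=\max(\log x,0)$. The conditional expectation $\mathbb{E}(\log\omega|\mathcal{F}_n)$ takes values in $[-\infty,\infty)$, with $\exp(-\infty)=0$. The tailed maximal operator is $M_n^*f=\sup_{m\ge n}|f_m|$, where $f_m=\mathbb{E}(f|\mathcal{F}_m)$. *)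

theory Defs
  imports "HOL-Probability.Probability"
begin

text \<open>
  The positive real powers of an extended nonnegative number, with \<open>\<infinity>\<close> sent to \<open>\<infinity>\<close>;
  only exponents \<open>a > 0\<close> are meaningful here.
\<close>
definition ennreal_powr :: "ennreal \<Rightarrow> real \<Rightarrow> ennreal" where
  "ennreal_powr t a = (if t = \<top> then \<top> else ennreal (enn2real t powr a))"

definition ereal_exp :: "ereal \<Rightarrow> ennreal" where
  "ereal_exp t = (case t of ereal r \<Rightarrow> ennreal (exp r) | PInfty \<Rightarrow> \<top> | MInfty \<Rightarrow> 0)"

definition log_plus :: "real \<Rightarrow> real" where
  "log_plus t = max (ln t) 0"

text \<open>
  Unlike \<^const>\<open>real_cond_exp\<close>, which turns infinite values into \<open>0\<close>, this version
  keeps them.  It is the usual notion as soon as one of the two parts has a finite conditional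
  expectation, e.g. for \<open>f = log \<omega>\<close> with \<open>\<omega>\<close> a weight, where the positive part is integrable and the
  values lie in \<open>[-\<infinity>, \<infinity>)\<close>.
\<close>
definition ereal_cond_exp :: "'a measure \<Rightarrow> 'a measure \<Rightarrow> ('a \<Rightarrow> real) \<Rightarrow> 'a \<Rightarrow> ereal" where
  "ereal_cond_exp M G f x =
     enn2ereal (nn_cond_exp M G (\<lambda>y. ennreal (f y)) x)
     - enn2ereal (nn_cond_exp M G (\<lambda>y. ennreal (- f y)) x)"

definition filtered_prob_space :: "'a measure \<Rightarrow> (nat \<Rightarrow> 'a measure) \<Rightarrow> bool" where
  "filtered_prob_space M F \<longleftrightarrow>
     prob_space M \<and> complete_measure M \<and>
     filtration (space M) F \<and> (\<forall>n. subalgebra M (F n)) \<and>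
     sets M = sigma_sets (space M) (\<Union>n. sets (F n))"

definition weight :: "'a measure \<Rightarrow> ('a \<Rightarrow> real) \<Rightarrow> bool" where
  "weight M \<omega> \<longleftrightarrow> integrable M \<omega> \<and> (AE x in M. 0 < \<omega> x)"

text \<open>
  Conditional expectation with respect to the measure \<open>\<omega> d\<mu>\<close>. This measure need not be
  normalised, which does not matter for conditional expectations; the quotient formula is
  \<open>weighted_cond_exp_eq\<close> below.
\<close>
definition weighted_cond_exp ::
  "'a measure \<Rightarrow> 'a measure \<Rightarrow> ('a \<Rightarrow> real) \<Rightarrow> ('a \<Rightarrow> ennreal) \<Rightarrow> 'a \<Rightarrow> ennreal" where
  "weighted_cond_exp M G \<omega> f = nn_cond_exp (density M (\<lambda>x. ennreal (\<omega> x))) G f"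

definition tailed_max ::
  "'a measure \<Rightarrow> (nat \<Rightarrow> 'a measure) \<Rightarrow> nat \<Rightarrow> ('a \<Rightarrow> real) \<Rightarrow> 'a \<Rightarrow> ennreal" where
  "tailed_max M F n f x = (SUP m\<in>{n..}. ennreal \<bar>real_cond_exp M (F m) f x\<bar>)"

definition A_p :: "'a measure \<Rightarrow> (nat \<Rightarrow> 'a measure) \<Rightarrow> real \<Rightarrow> ('a \<Rightarrow> real) set" where
  "A_p M F p = {\<omega>. \<exists>C>1. \<forall>n. AE x in M.
     ennreal (real_cond_exp M (F n) \<omega> x)
     * ennreal_powr (nn_cond_exp M (F n) (\<lambda>y. ennreal (\<omega> y powr (- 1 / (p - 1)))) x) (p - 1)
     \<le> ennreal C}"

definition RH_q :: "'a measure \<Rightarrow> (nat \<Rightarrow> 'a measure) \<Rightarrow> real \<Rightarrow> ('a \<Rightarrow> real) set" where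
  "RH_q M F q = {\<omega>. \<exists>C>1. \<forall>n. AE x in M.
     nn_cond_exp M (F n) (\<lambda>y. ennreal (\<omega> y powr q)) x
     \<le> ennreal (C * real_cond_exp M (F n) \<omega> x powr q)}"

definition A_inf_log :: "'a measure \<Rightarrow> (nat \<Rightarrow> 'a measure) \<Rightarrow> ('a \<Rightarrow> real) set" where
  "A_inf_log M F = {\<omega>. \<exists>C>1. \<forall>n. AE x in M.
     weighted_cond_exp M (F n) \<omega>
       (\<lambda>y. ennreal (log_plus (\<omega> y / real_cond_exp M (F n) \<omega> y))) x
     \<le> ennreal C}"

definition A_inf_exp :: "'a measure \<Rightarrow> (nat \<Rightarrow> 'a measure) \<Rightarrow> ('a \<Rightarrow> real) set" where
  "A_inf_exp M F = {\<omega>. \<exists>C>0. \<forall>n. AE x in M.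
     ennreal (real_cond_exp M (F n) \<omega> x)
     \<le> ennreal C * ereal_exp (ereal_cond_exp M (F n) (\<lambda>y. ln (\<omega> y)) x)}"

definition A_inf_star :: "'a measure \<Rightarrow> (nat \<Rightarrow> 'a measure) \<Rightarrow> ('a \<Rightarrow> real) set" where
  "A_inf_star M F = {\<omega>. \<exists>C>0. \<forall>n. AE x in M.
     nn_cond_exp M (F n) (tailed_max M F n \<omega>) x
     \<le> ennreal (C * real_cond_exp M (F n) \<omega> x)}"

lemma weight_cond_exp:
  assumes "prob_space M" "subalgebra M G" and w: "weight M \<omega>"
  shows "AE x in M. 0 < real_cond_exp M G \<omega> x"
    and "AE x in M. ennreal (real_cond_exp M G \<omega> x) = nn_cond_exp M G (\<lambda>y. ennreal (\<omega> y)) x"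
proof -
  interpret prob_space M by fact
  interpret finite_measure_subalgebra M G
    by unfold_locales fact
  have int: "integrable M \<omega>" and pos: "AE x in M. 0 < \<omega> x"
    using w by (auto simp: weight_def)
  have [measurable]: "\<omega> \<in> borel_measurable M" using int by simp
  show 1: "AE x in M. 0 < real_cond_exp M G \<omega> x"
    using real_cond_exp_gr_c[OF int pos] .
  have "AE x in M. nn_cond_exp M G (\<lambda>y. ennreal (- \<omega> y)) x = nn_cond_exp M G (\<lambda>y. 0) x"
    by (rule nn_cond_exp_cong) (use pos in \<open>auto simp: ennreal_neg\<close>)
  moreover have "AE x in M. 0 = nn_cond_exp M G (\<lambda>y. 0) x"
    by (rule nn_cond_exp_F_meas) simp
  moreover have "AE x in M. nn_cond_exp M G (\<lambda>y. ennreal (\<omega> y)) x \<noteq> \<infinity>"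
  proof (rule nn_integral_noteq_infinite)
    have "(\<integral>\<^sup>+ x. nn_cond_exp M G (\<lambda>y. ennreal (\<omega> y)) x \<partial>M) = (\<integral>\<^sup>+ x. ennreal (\<omega> x) \<partial>M)"
      using nn_cond_exp_intg[of "\<lambda>_. 1" "\<lambda>y. ennreal (\<omega> y)"] by simp
    also have "\<dots> < \<infinity>"
      using int by (simp add: real_integrable_def top.not_eq_extremum)
    finally show "(\<integral>\<^sup>+ x. nn_cond_exp M G (\<lambda>y. ennreal (\<omega> y)) x \<partial>M) \<noteq> \<infinity>" by simp
  qed simp
  ultimately show "AE x in M. ennreal (real_cond_exp M G \<omega> x) = nn_cond_exp M G (\<lambda>y. ennreal (\<omega> y)) x"
    by eventually_elim (simp add: real_cond_exp_def top.not_eq_extremum)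
qed

lemma weighted_cond_exp_eq:
  assumes "prob_space M" "subalgebra M G" and w: "weight M \<omega>"
    and [measurable]: "f \<in> borel_measurable M"
  shows "AE x in M. weighted_cond_exp M G \<omega> f x =
           nn_cond_exp M G (\<lambda>y. f y * ennreal (\<omega> y)) x / ennreal (real_cond_exp M G \<omega> x)"
proof -
  interpret prob_space M by fact
  interpret finite_measure_subalgebra M G
    by unfold_locales fact
  define N where "N = density M (\<lambda>x. ennreal (\<omega> x))"
  have int: "integrable M \<omega>" and pos: "AE x in M. 0 < \<omega> x"
    using w by (auto simp: weight_def)
  have [measurable]: "\<omega> \<in> borel_measurable M" using int by simp
  have subN: "subalgebra N G" using subalg by (simp add: subalgebra_def N_def)
  have "finite_measure N"
  proof
    have "emeasure N (space N) = (\<integral>\<^sup>+ x. ennreal (\<omega> x) \<partial>M)"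
      by (simp add: N_def emeasure_density cong: nn_integral_cong)
    also have "\<dots> \<noteq> \<infinity>" using int by (simp add: real_integrable_def)
    finally show "emeasure N (space N) \<noteq> \<infinity>" .
  qed
  then interpret N: finite_measure N .
  interpret N: finite_measure_subalgebra N G by unfold_locales (fact subN)
  define W where "W = (\<lambda>x. ennreal (real_cond_exp M G \<omega> x))"
  define H where "H = nn_cond_exp M G (\<lambda>y. f y * ennreal (\<omega> y))"
  have [measurable]: "W \<in> borel_measurable G" "H \<in> borel_measurable G"
    "W \<in> borel_measurable M" "H \<in> borel_measurable M"
    by (auto simp: W_def H_def)
  have "AE x in N. H x / W x = nn_cond_exp N G f x"
  proof (rule N.nn_cond_exp_charact)
    fix A assume A[measurable]: "A \<in> sets G"
    have AM[measurable]: "A \<in> sets M" using A subalg by (auto simp: subalgebra_def)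
    have "(\<integral>\<^sup>+ x\<in>A. H x / W x \<partial>N) = (\<integral>\<^sup>+ x. (H x / W x * indicator A x) * ennreal (\<omega> x) \<partial>M)"
      unfolding N_def by (subst nn_integral_density) (auto simp: mult_ac)
    also have "\<dots> = (\<integral>\<^sup>+ x. (H x / W x * indicator A x) * nn_cond_exp M G (\<lambda>y. ennreal (\<omega> y)) x \<partial>M)"
      by (rule nn_cond_exp_intg[symmetric]) auto
    also have "\<dots> = (\<integral>\<^sup>+ x. indicator A x * H x \<partial>M)"
    proof (rule nn_integral_cong_AE)
      show "AE x in M. H x / W x * indicator A x * nn_cond_exp M G (\<lambda>y. ennreal (\<omega> y)) x = indicator A x * H x"
        using weight_cond_exp[OF assms(1-3)]
      proof eventually_elim
        case (elim x)
        have "W x / W x = 1"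
          using elim(1) by (intro ennreal_divide_self) (auto simp: W_def)
        then have "H x / W x * W x = H x"
          by (simp add: ennreal_divide_times)
        then show ?case using elim(2) by (simp add: W_def mult_ac)
      qed
    qed
    also have "\<dots> = (\<integral>\<^sup>+ x. indicator A x * (f x * ennreal (\<omega> x)) \<partial>M)"
      unfolding H_def by (rule nn_cond_exp_intg) auto
    also have "\<dots> = (\<integral>\<^sup>+ x\<in>A. f x \<partial>N)"
      unfolding N_def by (subst nn_integral_density) (auto simp: mult_ac)
    finally show "(\<integral>\<^sup>+ x\<in>A. f x \<partial>N) = (\<integral>\<^sup>+ x\<in>A. H x / W x \<partial>N)" by simp
  qed (auto simp: N_def)
  then have "AE x in M. 0 < ennreal (\<omega> x) \<longrightarrow> H x / W x = nn_cond_exp N G f x"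
    unfolding N_def by (subst (asm) AE_density) auto
  with pos show ?thesis
    by eventually_elim (auto simp: weighted_cond_exp_def N_def H_def W_def)
qed

end

theory Submission
  imports Defs
begin

text \<open>
  Write \<open>\<omega>\<^sub>n = E(\<omega> | F\<^sub>n)\<close> and \<open>a\<^sub>n = E(\<surd>\<omega> | F\<^sub>n)\<close>.  All four conditions imply
  one reverse Jensen inequality, \<open>\<omega>\<^sub>n \<le> C a\<^sub>n\<^sup>2\<close> for all \<open>n\<close>, and this inequality gives
  \<open>A_inf_star\<close>: it bounds the maximal function of \<open>\<omega>\<close> by \<open>C (sup\<^sub>m a\<^sub>m)\<^sup>2\<close>, where \<open>\<surd>\<omega>\<close>
  is square integrable, so Doob's \<open>L\<^sup>2\<close> inequality conditional on \<open>F\<^sub>n\<close> applies to the martingale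
  \<open>a\<^sub>m\<close>, \<open>m \<ge> n\<close>, and yields the bound \<open>4 C E((\<surd>\<omega>)\<^sup>2 | F\<^sub>n) = 4 C \<omega>\<^sub>n\<close>
  (\<open>conditional_Doob_L2\<close>, \<open>A_inf_star_if_mean_le_sqrt_mean_square\<close>).

  The reverse Jensen inequality is reached in two ways.  \<open>RH_q\<close> and \<open>A_inf_log\<close> say that little of the
  conditional mass of \<open>\<omega>\<close> sits where \<open>\<omega> > K \<omega>\<^sub>n\<close>; for large \<open>K\<close> at least half of it sits where
  \<open>\<omega> \<le> K \<omega>\<^sub>n\<close>, and there \<open>\<omega> \<le> \<surd>(K \<omega>\<^sub>n) \<surd>\<omega>\<close> (\<open>mean_le_if_tail_le\<close>).  \<open>A_p\<close> and
  \<open>A_inf_exp\<close> bound \<open>\<omega>\<^sub>n\<close> by a generalised mean of \<open>\<omega>\<close> of exponent \<open>-1/(p-1)\<close> or \<open>0\<close>, and means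
  increase with the exponent, so the mean \<open>a\<^sub>n\<^sup>2\<close> of exponent \<open>1/2\<close> dominates it.

  The quantities \<open>E(\<omega>\<^sup>q | F\<^sub>n)\<close>, \<open>E(\<omega> powr (-1/(p-1)) | F\<^sub>n)\<close> and \<open>E(log\<^sup>- \<omega> | F\<^sub>n)\<close> are
  not known to be finite in advance.  Therefore every convexity argument below is a pointwise inequality between nonnegative
  functions with \<open>F\<^sub>n\<close>-measurable coefficients, to which the nonnegative conditional expectation is
  applied; no integrability of these functions has to be discussed.
\<close>

section \<open>Conditional expectations of nonnegative functions\<close>

lemma ennreal_two_mult_le_add_squares:
  fixes x y :: ennreal
  shows "2 * (x * y) \<le> x\<^sup>2 + y\<^sup>2"
proof (cases "x = \<top> \<or> y = \<top>")
  case True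
  then show ?thesis by (auto simp: power2_eq_square)
next
  case False
  then obtain a b where "x = ennreal a" "y = ennreal b" "0 \<le> a" "0 \<le> b"
    by (metis ennreal_cases)
  then show ?thesis
    by (simp add: ennreal_mult[symmetric] ennreal_power ennreal_plus[symmetric]
        ennreal_numeral[symmetric] ennreal_leI sum_squares_bound mult.assoc[symmetric]
        del: ennreal_plus ennreal_numeral)
qed

context sigma_finite_subalgebra
begin

lemma nn_cond_exp_lincomb:
  assumes [measurable]: "c \<in> borel_measurable F" "d \<in> borel_measurable F"
    "f \<in> borel_measurable M" "g \<in> borel_measurable M"
  shows "AE x in M. nn_cond_exp M F (\<lambda>x. c x * f x + d x * g x) x =
    c x * nn_cond_exp M F f x + d x * nn_cond_exp M F g x"
proof -
  note [measurable] = measurable_from_subalg[OF subalg assms(1)]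
    measurable_from_subalg[OF subalg assms(2)]
  have "AE x in M. nn_cond_exp M F (\<lambda>x. c x * f x) x + nn_cond_exp M F (\<lambda>x. d x * g x) x
      = nn_cond_exp M F (\<lambda>x. c x * f x + d x * g x) x"
    by (rule nn_cond_exp_sum) measurable
  with nn_cond_exp_prod[OF assms(1,3)] nn_cond_exp_prod[OF assms(2,4)]
  show ?thesis by eventually_elim simp
qed

text \<open>
  With \<open>a = E g\<close>, taking \<open>E\<close> in \<open>2 a g \<le> a\<^sup>2 + g\<^sup>2\<close> gives \<open>2 a\<^sup>2 \<le> a\<^sup>2 + E(g\<^sup>2)\<close>.  One \<open>a\<^sup>2\<close> can be
  cancelled only where \<open>a\<close> is finite; elsewhere \<open>2 g \<le> 1 + g\<^sup>2\<close> shows that \<open>E(g\<^sup>2)\<close> is infinite too.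
\<close>

lemma nn_cond_exp_square_le:
  assumes [measurable]: "g \<in> borel_measurable M"
  shows "AE x in M. (nn_cond_exp M F g x)\<^sup>2 \<le> nn_cond_exp M F (\<lambda>x. (g x)\<^sup>2) x"
proof -
  let ?a = "nn_cond_exp M F g"
  have const: "AE x in M. a = nn_cond_exp M F (\<lambda>_. a) x" for a
    by (rule nn_cond_exp_F_meas) simp
  have "AE x in M. nn_cond_exp M F (\<lambda>x. 2 * ?a x * g x + 0 * 0) x
      = 2 * ?a x * nn_cond_exp M F g x + 0 * nn_cond_exp M F (\<lambda>_. 0) x"
    by (rule nn_cond_exp_lincomb) measurable
  moreover have "AE x in M. nn_cond_exp M F (\<lambda>x. ?a x * ?a x + 1 * (g x)\<^sup>2) x
      = ?a x * nn_cond_exp M F ?a x + 1 * nn_cond_exp M F (\<lambda>x. (g x)\<^sup>2) x"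
    by (rule nn_cond_exp_lincomb) measurable
  moreover have "AE x in M. ?a x = nn_cond_exp M F ?a x"
    by (rule nn_cond_exp_F_meas) measurable
  moreover have "AE x in M. nn_cond_exp M F (\<lambda>x. 2 * ?a x * g x + 0 * 0) x
      \<le> nn_cond_exp M F (\<lambda>x. ?a x * ?a x + 1 * (g x)\<^sup>2) x"
    by (rule nn_cond_exp_mono)
      (use ennreal_two_mult_le_add_squares in \<open>auto simp: power2_eq_square mult.assoc\<close>)
  moreover have "AE x in M. nn_cond_exp M F (\<lambda>x. 1 * g x + 1 * g x) x
      = 1 * nn_cond_exp M F g x + 1 * nn_cond_exp M F g x"
    by (rule nn_cond_exp_lincomb) measurable
  moreover have "AE x in M. nn_cond_exp M F (\<lambda>x. 1 * g x + 1 * g x) x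
      \<le> nn_cond_exp M F (\<lambda>x. 1 * 1 + 1 * (g x)\<^sup>2) x"
    by (rule nn_cond_exp_mono)
      (use ennreal_two_mult_le_add_squares[of 1] in \<open>auto simp: mult_2\<close>)
  moreover have "AE x in M. nn_cond_exp M F (\<lambda>x. 1 * 1 + 1 * (g x)\<^sup>2) x
      = 1 * nn_cond_exp M F (\<lambda>_. 1) x + 1 * nn_cond_exp M F (\<lambda>x. (g x)\<^sup>2) x"
    by (rule nn_cond_exp_lincomb) measurable
  ultimately show ?thesis
    using const[of 1]
  proof eventually_elim
    case (elim x)
    show ?case
    proof (cases "?a x = \<top>")
      case True
      with elim(5-8) have "1 + nn_cond_exp M F (\<lambda>x. (g x)\<^sup>2) x = \<top>" by (auto simp: top_unique)
      then have "nn_cond_exp M F (\<lambda>x. (g x)\<^sup>2) x = \<top>" by (simp add: ennreal_add_eq_top)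
      then show ?thesis by simp
    next
      case False
      have "?a x * ?a x + ?a x * ?a x \<le> ?a x * ?a x + nn_cond_exp M F (\<lambda>x. (g x)\<^sup>2) x"
        using elim(1-4) by (simp add: mult_2 algebra_simps)
      with False show ?thesis
        by (auto simp: power2_eq_square ennreal_add_left_cancel_le ennreal_mult_eq_top_iff)
    qed
  qed
qed

lemma nn_cond_exp_SUP:
  assumes [measurable]: "\<And>i::nat. f i \<in> borel_measurable M"
    and inc: "incseq f"
  shows "AE x in M. nn_cond_exp M F (\<lambda>x. SUP i. f i x) x = (SUP i. nn_cond_exp M F (f i) x)"
proof -
  have mono: "AE x in M. \<forall>i. nn_cond_exp M F (f i) x \<le> nn_cond_exp M F (f (Suc i)) x"
    unfolding AE_all_countable
    using inc by (intro allI nn_cond_exp_mono) (auto simp: incseq_Suc_iff le_fun_def)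
  have "AE x in M. (SUP i. nn_cond_exp M F (f i) x) = nn_cond_exp M F (\<lambda>x. SUP i. f i x) x"
  proof (rule nn_cond_exp_charact)
    fix A assume A[measurable]: "A \<in> sets F"
    have AM[measurable]: "A \<in> sets M" using A subalg by (auto simp: subalgebra_def)
    have "(\<integral>\<^sup>+x\<in>A. (SUP i. f i x) \<partial>M) = (\<integral>\<^sup>+x. (SUP i. indicator A x * f i x) \<partial>M)"
      by (simp add: SUP_mult_left_ennreal mult.commute)
    also have "\<dots> = (SUP i. \<integral>\<^sup>+x. indicator A x * f i x \<partial>M)"
      using inc by (intro nn_integral_monotone_convergence_SUP)
        (auto simp: incseq_Suc_iff le_fun_def intro!: mult_left_mono)
    also have "\<dots> = (SUP i. \<integral>\<^sup>+x. indicator A x * nn_cond_exp M F (f i) x \<partial>M)"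
      by (simp add: nn_cond_exp_intg)
    also have "\<dots> = (\<integral>\<^sup>+x. (SUP i. indicator A x * nn_cond_exp M F (f i) x) \<partial>M)"
      using mono by (intro nn_integral_monotone_convergence_SUP_AE[symmetric])
        (auto intro!: mult_left_mono)
    also have "\<dots> = (\<integral>\<^sup>+x\<in>A. (SUP i. nn_cond_exp M F (f i) x) \<partial>M)"
      by (simp add: SUP_mult_left_ennreal mult.commute)
    finally show "(\<integral>\<^sup>+x\<in>A. (SUP i. f i x) \<partial>M) = (\<integral>\<^sup>+x\<in>A. (SUP i. nn_cond_exp M F (f i) x) \<partial>M)" .
  qed measurable
  then show ?thesis by eventually_elim simp
qed

end

section \<open>Doob's maximal inequality in \<open>L\<^sup>2\<close>, conditionally\<close>

text \<open>
  This is the pathwise form of Doob's \<open>L\<^sup>2\<close> inequality for a running maximum \<open>S\<close> that is updated by a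
  new value \<open>G\<close>: the quantity \<open>S\<^sup>2 - 2 S G\<close> does not increase in the update.  The negative terms are
  moved across because the values lie in \<open>ennreal\<close>.
\<close>

lemma running_max_step:
  fixes S G :: ennreal
  shows "(sup S G)\<^sup>2 + 2 * (S * G) \<le> S\<^sup>2 + 2 * (sup S G * G)"
proof (cases "G \<le> S")
  case True
  then show ?thesis by (simp add: sup_absorb1)
next
  case False
  then have "sup S G = G" by (simp add: sup_absorb2)
  have "G\<^sup>2 + 2 * (S * G) \<le> G\<^sup>2 + (S\<^sup>2 + G\<^sup>2)"
    by (intro add_left_mono ennreal_two_mult_le_add_squares)
  also have "\<dots> = S\<^sup>2 + 2 * (G * G)"
    by (simp add: power2_eq_square mult_2 add_ac)
  finally show ?thesis using \<open>sup S G = G\<close> by simp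
qed

text \<open>
  Let \<open>S\<^sub>k\<close> be the running maximum of the martingale \<open>G\<^sub>k = E(g | F\<^sub>k)\<close>, and put \<open>I\<^sub>k = E(S\<^sub>k\<^sup>2 | F\<^sub>0)\<close>,
  \<open>J\<^sub>k = E(S\<^sub>k g | F\<^sub>0)\<close>.  As \<open>S\<^sub>k\<close> is \<open>F\<^sub>j\<close>-measurable for \<open>j \<ge> k\<close>, \<open>E(S\<^sub>k G\<^sub>j | F\<^sub>0) = J\<^sub>k\<close>, so that
  \<open>running_max_step\<close> makes \<open>I\<^sub>k - 2 J\<^sub>k\<close> decreasing in \<open>k\<close>.  It starts at \<open>-I\<^sub>0 \<le> 0\<close>, so
  \<open>I\<^sub>k \<le> 2 J\<^sub>k\<close>; together with \<open>4 S\<^sub>k g \<le> S\<^sub>k\<^sup>2 + 4 g\<^sup>2\<close> this gives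
  \<open>2 I\<^sub>k \<le> I\<^sub>k + 4 E(g\<^sup>2 | F\<^sub>0)\<close>.  Cancellation requires \<open>I\<^sub>k\<close> to be finite, which
  \<open>S\<^sub>k\<^sub>+\<^sub>1\<^sup>2 \<le> S\<^sub>k\<^sup>2 + G\<^sub>k\<^sub>+\<^sub>1\<^sup>2\<close> and \<open>nn_cond_exp_square_le\<close> ensure wherever \<open>E(g\<^sup>2 | F\<^sub>0)\<close> is finite.  Where it is infinite, the
  claim is trivial.
\<close>

lemma conditional_Doob_L2:
  fixes g :: "'a \<Rightarrow> ennreal" and F :: "nat \<Rightarrow> 'a measure"
  assumes "finite_measure M"
    and sub: "\<And>i. subalgebra M (F i)" and nested: "\<And>i j. i \<le> j \<Longrightarrow> subalgebra (F j) (F i)"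
    and [measurable]: "g \<in> borel_measurable M"
  shows "AE x in M. nn_cond_exp M (F 0) (\<lambda>x. (SUP i. nn_cond_exp M (F i) g x)\<^sup>2) x
    \<le> 4 * nn_cond_exp M (F 0) (\<lambda>x. (g x)\<^sup>2) x"
proof -
  interpret finite_measure M by fact
  interpret F: finite_measure_subalgebra M "F i" for i
    by unfold_locales (rule sub)
  define G where "G = (\<lambda>i. nn_cond_exp M (F i) g)"
  define S where "S = (\<lambda>k x. SUP i\<in>{..k}. G i x)"
  define V where "V = nn_cond_exp M (F 0) (\<lambda>x. (g x)\<^sup>2)"
  define I where "I = (\<lambda>k. nn_cond_exp M (F 0) (\<lambda>x. (S k x)\<^sup>2))"
  define J where "J = (\<lambda>k. nn_cond_exp M (F 0) (\<lambda>x. S k x * g x))"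
  have [measurable]: "G i \<in> borel_measurable M" for i
    unfolding G_def by measurable
  have GF: "G i \<in> borel_measurable (F j)" if "i \<le> j" for i j
    unfolding G_def by (rule measurable_from_subalg[OF nested[OF that] borel_measurable_nn_cond_exp])
  have [measurable]: "S k \<in> borel_measurable M" for k
    unfolding S_def by measurable
  have SF: "S k \<in> borel_measurable (F j)" if "k \<le> j" for k j
    unfolding S_def using that by (intro borel_measurable_SUP GF) auto
  have S_Suc: "S (Suc k) x = sup (S k x) (G (Suc k) x)" for k x
    by (simp add: S_def atMost_Suc sup_commute)
  have S_0: "S 0 x = G 0 x" for x
    by (simp add: S_def)
  \<comment> \<open>the tower property through \<open>F j\<close>, where \<open>S k\<close> can be taken out\<close>
  have pull: "AE x in M. nn_cond_exp M (F 0) (\<lambda>x. S k x * G j x) x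
      = nn_cond_exp M (F 0) (\<lambda>x. S k x * g x) x" if "k \<le> j" for k j
  proof -
    note [measurable] = SF[OF that]
    have "AE x in M. S k x * G j x = nn_cond_exp M (F j) (\<lambda>x. S k x * g x) x"
      unfolding G_def by (rule F.nn_cond_exp_prod) measurable
    then have "AE x in M. nn_cond_exp M (F 0) (\<lambda>x. S k x * G j x) x
        = nn_cond_exp M (F 0) (nn_cond_exp M (F j) (\<lambda>x. S k x * g x)) x"
      by (rule F.nn_cond_exp_cong) measurable
    moreover have "AE x in M. nn_cond_exp M (F 0) (\<lambda>x. S k x * g x) x
        = nn_cond_exp M (F 0) (nn_cond_exp M (F j) (\<lambda>x. S k x * g x)) x"
      by (rule F.nn_cond_exp_nested_subalg[OF sub nested]) auto
    ultimately show ?thesis by eventually_elim simp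
  qed
  have step: "AE x in M. \<forall>k. I (Suc k) x + 2 * J k x \<le> I k x + 2 * J (Suc k) x"
    unfolding AE_all_countable
  proof
    fix k
    have "AE x in M. nn_cond_exp M (F 0) (\<lambda>x. 1 * (S (Suc k) x)\<^sup>2 + 2 * (S k x * G (Suc k) x)) x
      \<le> nn_cond_exp M (F 0) (\<lambda>x. 1 * (S k x)\<^sup>2 + 2 * (S (Suc k) x * G (Suc k) x)) x"
      by (rule F.nn_cond_exp_mono) (auto simp: S_Suc intro: running_max_step)
    moreover have "AE x in M. nn_cond_exp M (F 0)
        (\<lambda>x. 1 * (S (Suc k) x)\<^sup>2 + 2 * (S k x * G (Suc k) x)) x
      = 1 * I (Suc k) x + 2 * nn_cond_exp M (F 0) (\<lambda>x. S k x * G (Suc k) x) x"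
      unfolding I_def by (rule F.nn_cond_exp_lincomb) measurable
    moreover have "AE x in M. nn_cond_exp M (F 0)
        (\<lambda>x. 1 * (S k x)\<^sup>2 + 2 * (S (Suc k) x * G (Suc k) x)) x
      = 1 * I k x + 2 * nn_cond_exp M (F 0) (\<lambda>x. S (Suc k) x * G (Suc k) x) x"
      unfolding I_def by (rule F.nn_cond_exp_lincomb) measurable
    ultimately show "AE x in M. I (Suc k) x + 2 * J k x \<le> I k x + 2 * J (Suc k) x"
      using pull[of k "Suc k", OF le_SucI[OF order_refl]] pull[of "Suc k" "Suc k", OF order_refl]
      unfolding J_def by eventually_elim simp
  qed
  have start: "AE x in M. I 0 x = J 0 x"
    using pull[of 0 0] by (simp add: I_def J_def S_0 power2_eq_square)
  have absorb: "AE x in M. \<forall>k. 4 * J k x \<le> I k x + 4 * V x"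
    unfolding AE_all_countable
  proof
    fix k
    have "4 * (s * h) \<le> s\<^sup>2 + 4 * h\<^sup>2" for s h :: ennreal
      using ennreal_two_mult_le_add_squares[of s "2 * h"] by (simp add: power_mult_distrib mult_ac)
    then have "AE x in M. nn_cond_exp M (F 0) (\<lambda>x. 4 * (S k x * g x) + 0 * 0) x
      \<le> nn_cond_exp M (F 0) (\<lambda>x. 1 * (S k x)\<^sup>2 + 4 * (g x)\<^sup>2) x"
      by (intro F.nn_cond_exp_mono) auto
    moreover have "AE x in M. nn_cond_exp M (F 0) (\<lambda>x. 4 * (S k x * g x) + 0 * 0) x
        = 4 * J k x + 0 * nn_cond_exp M (F 0) (\<lambda>_. 0) x"
      unfolding J_def by (rule F.nn_cond_exp_lincomb) measurable
    moreover have "AE x in M. nn_cond_exp M (F 0) (\<lambda>x. 1 * (S k x)\<^sup>2 + 4 * (g x)\<^sup>2) x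
        = 1 * I k x + 4 * V x"
      unfolding I_def V_def by (rule F.nn_cond_exp_lincomb) measurable
    ultimately show "AE x in M. 4 * J k x \<le> I k x + 4 * V x"
      by eventually_elim simp
  qed
  have G_sq: "AE x in M. nn_cond_exp M (F 0) (\<lambda>x. (G i x)\<^sup>2) x \<le> V x" for i
  proof -
    have "AE x in M. nn_cond_exp M (F 0) (\<lambda>x. (G i x)\<^sup>2) x
        \<le> nn_cond_exp M (F 0) (nn_cond_exp M (F i) (\<lambda>x. (g x)\<^sup>2)) x"
      unfolding G_def by (intro F.nn_cond_exp_mono F.nn_cond_exp_square_le) auto
    moreover have "AE x in M. V x = nn_cond_exp M (F 0) (nn_cond_exp M (F i) (\<lambda>x. (g x)\<^sup>2)) x"
      unfolding V_def by (rule F.nn_cond_exp_nested_subalg[OF sub nested]) auto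
    ultimately show ?thesis by eventually_elim simp
  qed
  have growth: "AE x in M. \<forall>k. I (Suc k) x \<le> I k x + V x"
    unfolding AE_all_countable
  proof
    fix k
    have "(sup s t)\<^sup>2 \<le> s\<^sup>2 + t\<^sup>2" for s t :: ennreal
      by (cases s t rule: linorder_le_cases) (auto simp: sup_absorb1 sup_absorb2)
    then have "AE x in M. I (Suc k) x
      \<le> nn_cond_exp M (F 0) (\<lambda>x. (S k x)\<^sup>2 + (G (Suc k) x)\<^sup>2) x"
      unfolding I_def by (intro F.nn_cond_exp_mono) (auto simp: S_Suc)
    moreover have "AE x in M. I k x + nn_cond_exp M (F 0) (\<lambda>x. (G (Suc k) x)\<^sup>2) x
        = nn_cond_exp M (F 0) (\<lambda>x. (S k x)\<^sup>2 + (G (Suc k) x)\<^sup>2) x"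
      unfolding I_def by (rule F.nn_cond_exp_sum) measurable
    ultimately show "AE x in M. I (Suc k) x \<le> I k x + V x"
      using G_sq[of "Suc k"]
      by eventually_elim (metis add_left_mono order_trans)
  qed
  have init: "AE x in M. I 0 x \<le> V x"
    using G_sq[of 0] by (simp add: I_def S_0)
  have bound: "AE x in M. \<forall>k. I k x \<le> 4 * V x"
    using step start absorb growth init
  proof eventually_elim
    case (elim x)
    show ?case
    proof (cases "V x = \<top>")
      case True
      then show ?thesis by (simp add: ennreal_mult_top)
    next
      case False
      have I_fin: "I k x \<noteq> \<top>" for k
      proof (induction k)
        case 0
        then show ?case using elim False by (auto simp: top_unique)
      next
        case (Suc k)
        then show ?case using elim(4) False by (metis ennreal_add_eq_top top_unique)
      qed
      have J_fin: "2 * J k x \<noteq> \<top>" for k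
        using elim(3)[rule_format, of k] I_fin[of k] False
        by (auto simp: ennreal_mult_eq_top_iff top_unique)
      have IJ: "I k x \<le> 2 * J k x" for k
      proof (induction k)
        case 0
        then show ?case using elim(2) by (simp add: mult_2)
      next
        case (Suc k)
        have "2 * J k x + I (Suc k) x \<le> I k x + 2 * J (Suc k) x"
          using elim(1) by (simp add: add.commute)
        also have "\<dots> \<le> 2 * J k x + 2 * J (Suc k) x"
          using Suc by (intro add_right_mono)
        finally show ?case
          using J_fin[of k] by (simp add: ennreal_add_left_cancel_le)
      qed
      show ?thesis
      proof
        fix k
        have "I k x + I k x \<le> 2 * J k x + 2 * J k x"
          by (intro add_mono IJ)
        also have "\<dots> = 4 * J k x"
          by (simp flip: distrib_right)
        also have "\<dots> \<le> I k x + 4 * V x"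
          using elim(3) by simp
        finally show "I k x \<le> 4 * V x"
          using I_fin[of k] by (simp add: ennreal_add_left_cancel_le)
      qed
    qed
  qed
  have S_inc: "incseq (\<lambda>k x. (S k x)\<^sup>2)"
    by (auto simp: incseq_Suc_iff le_fun_def S_Suc intro!: power_mono)
  have sup_sq: "(SUP i. G i x)\<^sup>2 = (SUP k. (S k x)\<^sup>2)" for x
  proof -
    have "(SUP i. G i x) = (SUP k. S k x)"
      unfolding S_def by (intro antisym SUP_least) (auto intro: SUP_upper2 SUP_upper)
    then have "(SUP i. G i x)\<^sup>2 = (SUP k. S k x)\<^sup>2" by simp
    \<comment> \<open>the supremum of the products is attained along the diagonal, as \<open>S\<close> increases\<close>
    also have "(SUP k. S k x)\<^sup>2 = (SUP k. SUP l. S l x * S k x)"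
      by (simp add: power2_eq_square SUP_mult_left_ennreal SUP_mult_right_ennreal)
    also have "\<dots> = (SUP k. (S k x)\<^sup>2)"
    proof (rule antisym)
      have "S k x \<le> S l x" if "k \<le> l" for k l
        unfolding S_def using that by (intro SUP_subset_mono) auto
      then have "S l x * S k x \<le> (S (max k l) x)\<^sup>2" for k l
        by (simp add: power2_eq_square mult_mono)
      then show "(SUP k. SUP l. S l x * S k x) \<le> (SUP k. (S k x)\<^sup>2)"
        by (meson SUP_least SUP_upper2 UNIV_I)
      show "(SUP k. (S k x)\<^sup>2) \<le> (SUP k. SUP l. S l x * S k x)"
        by (intro SUP_mono) (auto simp: power2_eq_square intro!: exI SUP_upper2[OF UNIV_I order_refl])
    qed
    finally show ?thesis .
  qed
  have "AE x in M. nn_cond_exp M (F 0) (\<lambda>x. (SUP i. G i x)\<^sup>2) x = (SUP k. I k x)"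
    unfolding I_def sup_sq by (rule F.nn_cond_exp_SUP[OF _ S_inc]) measurable
  with bound have "AE x in M. nn_cond_exp M (F 0) (\<lambda>x. (SUP i. G i x)\<^sup>2) x \<le> 4 * V x"
  proof eventually_elim
    case (elim x)
    show ?case
      unfolding elim(2) using elim(1) by (intro SUP_least) blast
  qed
  then show ?thesis
    unfolding G_def V_def .
qed

section \<open>Comparing the conditional means of \<open>\<omega>\<close> and \<open>\<surd>\<omega>\<close>\<close>

locale weighted_subalgebra = prob_space M for M :: "'a measure" +
  fixes G :: "'a measure" and \<omega> :: "'a \<Rightarrow> real"
  assumes subalgebra_G: "subalgebra M G" and weight: "weight M \<omega>"
begin

sublocale finite_measure_subalgebra M G
  by unfold_locales (rule subalgebra_G)

abbreviation mean :: "'a \<Rightarrow> real" where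
  "mean \<equiv> real_cond_exp M G \<omega>"

abbreviation sqrt_mean :: "'a \<Rightarrow> real" where
  "sqrt_mean \<equiv> real_cond_exp M G (\<lambda>y. sqrt (\<omega> y))"

lemma weight_measurable [measurable]: "\<omega> \<in> borel_measurable M"
  and weight_pos: "AE x in M. 0 < \<omega> x"
  using weight by (auto simp: weight_def)

lemma weight_sqrt: "weight M (\<lambda>y. sqrt (\<omega> y))"
proof -
  have "integrable M (\<lambda>y. sqrt (\<omega> y))"
  proof (rule Bochner_Integration.integrable_bound)
    show "integrable M (\<lambda>y. 1 + \<omega> y)"
      using weight by (simp add: weight_def)
    show "AE x in M. norm (sqrt (\<omega> x)) \<le> norm (1 + \<omega> x)"
      using weight_pos
    proof eventually_elim
      case (elim x)
      then have "sqrt (\<omega> x) \<le> 1 + \<omega> x"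
        by (intro real_le_lsqrt) (auto simp: power2_eq_square algebra_simps)
      with elim show ?case by simp
    qed
  qed measurable
  then show ?thesis using weight_pos by (simp add: weight_def)
qed

lemmas mean_pos = weight_cond_exp(1)[OF prob_space_axioms subalgebra_G weight]
  and mean_eq = weight_cond_exp(2)[OF prob_space_axioms subalgebra_G weight]
  and sqrt_mean_pos = weight_cond_exp(1)[OF prob_space_axioms subalgebra_G weight_sqrt]
  and sqrt_mean_eq = weight_cond_exp(2)[OF prob_space_axioms subalgebra_G weight_sqrt]

text \<open>
  The term \<open>\<surd>(K mean) \<surd>\<omega>\<close> bounds \<open>\<omega>\<close> where \<open>\<omega> \<le> K mean\<close>, so \<open>d f\<close> has to dominate \<open>\<omega>\<close> only on the
  tail \<open>\<omega> > K mean\<close>.  If \<open>d f\<close> takes at most half of the conditional mean, the rest satisfies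
  \<open>mean / 2 \<le> \<surd>(K mean) sqrt_mean\<close>.
\<close>

lemma mean_le_if_tail_le:
  assumes [measurable]: "d \<in> borel_measurable G" "f \<in> borel_measurable M" and "0 < K"
    and split: "AE x in M. ennreal (\<omega> x) \<le> d x * f x + ennreal (sqrt (K * mean x) * sqrt (\<omega> x))"
    and tail: "AE x in M. d x * nn_cond_exp M G f x \<le> ennreal (mean x / 2)"
  shows "AE x in M. mean x \<le> 4 * K * (sqrt_mean x)\<^sup>2"
proof -
  note [measurable] = measurable_from_subalg[OF subalg assms(1)]
  have "AE x in M. nn_cond_exp M G (\<lambda>x. ennreal (\<omega> x)) x
     \<le> nn_cond_exp M G (\<lambda>x. d x * f x + ennreal (sqrt (K * mean x)) * ennreal (sqrt (\<omega> x))) x"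
    using split weight_pos mean_pos
    by (intro nn_cond_exp_mono) (auto simp: ennreal_mult \<open>0 < K\<close> less_imp_le)
  moreover have "AE x in M.
     nn_cond_exp M G (\<lambda>x. d x * f x + ennreal (sqrt (K * mean x)) * ennreal (sqrt (\<omega> x))) x
      = d x * nn_cond_exp M G f x
        + ennreal (sqrt (K * mean x)) * nn_cond_exp M G (\<lambda>x. ennreal (sqrt (\<omega> x))) x"
    by (rule nn_cond_exp_lincomb) measurable
  ultimately show ?thesis
    using tail mean_eq sqrt_mean_eq mean_pos sqrt_mean_pos
  proof eventually_elim
    case (elim x)
    let ?v = "mean x" and ?a = "sqrt_mean x"
    have "ennreal ?v \<le> d x * nn_cond_exp M G f x + ennreal (sqrt (K * ?v)) * ennreal ?a"
      using elim(1,2) unfolding elim(4,5) by simp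
    also have "\<dots> \<le> ennreal (?v / 2) + ennreal (sqrt (K * ?v)) * ennreal ?a"
      using elim(3) by (rule add_right_mono)
    finally have "?v \<le> ?v / 2 + sqrt (K * ?v) * ?a"
      using elim(6,7) \<open>0 < K\<close> by (simp flip: ennreal_mult ennreal_plus)
    then have "?v / 2 \<le> sqrt (K * ?v) * ?a" by simp
    then have "(?v / 2)\<^sup>2 \<le> (sqrt (K * ?v) * ?a)\<^sup>2"
      using elim(6) by (intro power_mono) auto
    also have "\<dots> = ?v * (K * ?a\<^sup>2)"
      using elim(6) \<open>0 < K\<close> by (simp add: power_mult_distrib)
    finally show ?case
      using elim(6) by (simp add: power2_eq_square field_simps)
  qed
qed

text \<open>
  On the tail \<open>\<omega> > K mean\<close> one has \<open>\<omega> \<le> (K mean) powr (1 - q) * \<omega> powr q\<close>, and the conditional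
  expectation of the right-hand side is at most \<open>K powr (1 - q) * C * mean\<close>.  The value
  \<open>K = (2 C) powr (1 / (q - 1))\<close> is the one that makes this \<open>mean / 2\<close>.
\<close>

lemma mean_le_of_reverse_Hoelder:
  assumes "1 < C" "1 < q"
    and RH: "AE x in M. nn_cond_exp M G (\<lambda>y. ennreal (\<omega> y powr q)) x \<le> ennreal (C * mean x powr q)"
  shows "AE x in M. mean x \<le> 4 * (2 * C) powr (1 / (q - 1)) * (sqrt_mean x)\<^sup>2"
proof -
  define K where "K = (2 * C) powr (1 / (q - 1))"
  have K: "0 < K" "K powr (q - 1) = 2 * C"
    using assms(1,2) by (auto simp: K_def powr_powr)
  define d where "d = (\<lambda>x. (K * mean x) powr (1 - q))"
  have [measurable]: "d \<in> borel_measurable G"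
    unfolding d_def by measurable
  have "AE x in M. mean x \<le> 4 * K * (sqrt_mean x)\<^sup>2"
  proof (rule mean_le_if_tail_le[where d = "\<lambda>x. ennreal (d x)" and f = "\<lambda>x. ennreal (\<omega> x powr q)"])
    show "AE x in M. ennreal (\<omega> x) \<le> ennreal (d x) * ennreal (\<omega> x powr q)
        + ennreal (sqrt (K * mean x) * sqrt (\<omega> x))"
      using weight_pos mean_pos
    proof eventually_elim
      case (elim x)
      have "\<omega> x \<le> d x * \<omega> x powr q + sqrt (K * mean x) * sqrt (\<omega> x)"
      proof (cases "\<omega> x \<le> K * mean x")
        case True
        then have "sqrt (\<omega> x) * sqrt (\<omega> x) \<le> sqrt (K * mean x) * sqrt (\<omega> x)"
          by (intro mult_right_mono) (use elim in auto)
        moreover have "0 \<le> d x * \<omega> x powr q"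
          by (simp add: d_def)
        ultimately show ?thesis
          using elim by simp
      next
        case False
        have "\<omega> x = \<omega> x powr (1 - q) * \<omega> x powr q"
          using elim by (simp flip: powr_add)
        also have "\<dots> \<le> d x * \<omega> x powr q"
          unfolding d_def using False elim K \<open>1 < q\<close>
          by (intro mult_right_mono powr_mono2') auto
        finally show ?thesis
          using elim K by (simp add: add_increasing2)
      qed
      then show ?case
        using elim K by (simp add: d_def flip: ennreal_mult ennreal_plus)
    qed
    show "AE x in M. ennreal (d x) * nn_cond_exp M G (\<lambda>x. ennreal (\<omega> x powr q)) x
        \<le> ennreal (mean x / 2)"
      using RH mean_pos
    proof eventually_elim
      case (elim x)
      have "d x * (C * mean x powr q) = K powr (1 - q) * C * (mean x powr (1 - q) * mean x powr q)"
        using elim K by (simp add: d_def powr_mult)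
      also have "\<dots> = mean x / 2"
        using elim K assms(1) powr_minus[of K "q - 1"]
        by (simp add: field_simps flip: powr_add)
      finally have eq: "d x * (C * mean x powr q) = mean x / 2" .
      have "ennreal (d x) * nn_cond_exp M G (\<lambda>x. ennreal (\<omega> x powr q)) x
          \<le> ennreal (d x) * ennreal (C * mean x powr q)"
        using elim(1) by (rule mult_left_mono) simp
      also have "\<dots> = ennreal (d x * (C * mean x powr q))"
        using assms(1) by (intro ennreal_mult[symmetric]) (auto simp: d_def)
      finally show ?case unfolding eq .
    qed
    show "0 < K" by (rule K)
  qed measurable
  then show ?thesis by (simp add: K_def)
qed

text \<open>
  On the tail \<open>\<omega> > exp (2 C) * mean\<close> the factor \<open>log\<^sup>+ (\<omega> / mean)\<close> exceeds \<open>2 C\<close>, so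
  \<open>\<omega> \<le> \<omega> log\<^sup>+ (\<omega> / mean) / (2 C)\<close>.  The hypothesis bounds the conditional expectation of
  \<open>\<omega> log\<^sup>+ (\<omega> / mean)\<close> by \<open>C * mean\<close>, by the quotient formula for weighted conditional expectations.
\<close>

lemma mean_le_of_log_bound:
  assumes "1 < C"
    and log: "AE x in M. weighted_cond_exp M G \<omega> (\<lambda>y. ennreal (log_plus (\<omega> y / mean y))) x \<le> ennreal C"
  shows "AE x in M. mean x \<le> 4 * exp (2 * C) * (sqrt_mean x)\<^sup>2"
proof -
  define f where "f = (\<lambda>x. log_plus (\<omega> x / mean x))"
  have [measurable]: "f \<in> borel_measurable M"
    unfolding f_def log_plus_def by measurable
  have f_nonneg: "0 \<le> f x" for x by (simp add: f_def log_plus_def)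
  show ?thesis
  proof (rule mean_le_if_tail_le[where d = "\<lambda>_. ennreal (1 / (2 * C))" and f = "\<lambda>x. ennreal (f x) * ennreal (\<omega> x)"])
    show "AE x in M. ennreal (\<omega> x) \<le> ennreal (1 / (2 * C)) * (ennreal (f x) * ennreal (\<omega> x))
        + ennreal (sqrt (exp (2 * C) * mean x) * sqrt (\<omega> x))"
      using weight_pos mean_pos
    proof eventually_elim
      case (elim x)
      have "\<omega> x \<le> 1 / (2 * C) * (f x * \<omega> x) + sqrt (exp (2 * C) * mean x) * sqrt (\<omega> x)"
      proof (cases "\<omega> x \<le> exp (2 * C) * mean x")
        case True
        then have "sqrt (\<omega> x) * sqrt (\<omega> x) \<le> sqrt (exp (2 * C) * mean x) * sqrt (\<omega> x)"
          by (intro mult_right_mono) (use elim in auto)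
        moreover have "0 \<le> 1 / (2 * C) * (f x * \<omega> x)"
          using elim f_nonneg \<open>1 < C\<close> by simp
        ultimately show ?thesis
          using elim by simp
      next
        case False
        then have "exp (2 * C) \<le> \<omega> x / mean x"
          using elim by (simp add: field_simps)
        then have "2 * C \<le> ln (\<omega> x / mean x)"
          using elim by (subst ln_ge_iff) auto
        then have "2 * C \<le> f x"
          by (simp add: f_def log_plus_def)
        then have "\<omega> x \<le> 1 / (2 * C) * (f x * \<omega> x)"
          using elim \<open>1 < C\<close> by (simp add: field_simps)
        then show ?thesis
          using elim by (simp add: add_increasing2)
      qed
      then show ?case
        using elim f_nonneg \<open>1 < C\<close> by (simp flip: ennreal_mult ennreal_plus)
    qed
    have "AE x in M. weighted_cond_exp M G \<omega> (\<lambda>y. ennreal (f y)) x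
        = nn_cond_exp M G (\<lambda>y. ennreal (f y) * ennreal (\<omega> y)) x / ennreal (mean x)"
      by (rule weighted_cond_exp_eq[OF prob_space_axioms subalgebra_G weight]) measurable
    with log mean_pos show "AE x in M. ennreal (1 / (2 * C))
        * nn_cond_exp M G (\<lambda>x. ennreal (f x) * ennreal (\<omega> x)) x \<le> ennreal (mean x / 2)"
    proof eventually_elim
      case (elim x)
      let ?E = "nn_cond_exp M G (\<lambda>y. ennreal (f y) * ennreal (\<omega> y)) x"
      have "?E / ennreal (mean x) \<le> ennreal C"
        using elim(1,3) by (simp add: f_def)
      then have "?E / ennreal (mean x) * ennreal (mean x) \<le> ennreal C * ennreal (mean x)"
        by (rule mult_right_mono) simp
      then have "?E \<le> ennreal C * ennreal (mean x)"
        using elim(2) by (simp add: ennreal_divide_times ennreal_divide_self)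
      then have "ennreal (1 / (2 * C)) * ?E \<le> ennreal (1 / (2 * C)) * (ennreal C * ennreal (mean x))"
        by (rule mult_left_mono) simp
      also have "\<dots> = ennreal (mean x / 2)"
        using elim(2) \<open>1 < C\<close> by (simp flip: ennreal_mult)
      finally show ?case .
    qed
    show "0 < exp (2 * C)" by simp
  qed measurable
qed

text \<open>
  With \<open>s = 1 / (p - 1)\<close> and \<open>a = sqrt_mean\<close>, Jensen's inequality for the convex function
  \<open>y powr (- 2 * s)\<close> at \<open>y = \<surd>\<omega>\<close> gives \<open>a powr (- 2 * s) \<le> E(\<omega> powr (- s))\<close>, that is,
  \<open>a powr (- 2) \<le> E(\<omega> powr (- s)) powr (p - 1)\<close>.  It is proved by applying \<open>E\<close> to the tangent line
  of this function at \<open>y = a\<close>, written as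
  \<open>(1 + 2 * s) * a powr (- 2 * s) \<le> \<omega> powr (- s) + 2 * s * a powr (- 2 * s - 1) * \<surd>\<omega>\<close>
  so that all terms are nonnegative.
\<close>

lemma mean_le_of_Muckenhoupt:
  assumes "1 < C" "1 < p"
    and Ap: "AE x in M. ennreal (mean x)
      * ennreal_powr (nn_cond_exp M G (\<lambda>y. ennreal (\<omega> y powr (- 1 / (p - 1)))) x) (p - 1) \<le> ennreal C"
  shows "AE x in M. mean x \<le> C * (sqrt_mean x)\<^sup>2"
proof -
  define s where "s = 1 / (p - 1)"
  have s: "0 < s" "s * (p - 1) = 1" "- 1 / (p - 1) = - s"
    using \<open>1 < p\<close> unfolding s_def by simp_all
  define c where "c = (\<lambda>x. 2 * s * sqrt_mean x powr (- 2 * s - 1))"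
  define u where "u = (\<lambda>x. ennreal ((1 + 2 * s) * sqrt_mean x powr (- 2 * s)))"
  have c_nonneg: "0 \<le> c x" for x using s by (simp add: c_def)
  have [measurable]: "c \<in> borel_measurable G" "u \<in> borel_measurable G" "u \<in> borel_measurable M"
    "c \<in> borel_measurable M"
    unfolding c_def u_def by measurable
  have "AE x in M. u x \<le> 1 * ennreal (\<omega> x powr (- s)) + ennreal (c x) * ennreal (sqrt (\<omega> x))"
    using weight_pos sqrt_mean_pos
  proof eventually_elim
    case (elim x)
    define a where "a = sqrt_mean x"
    define t where "t = sqrt (\<omega> x) / a"
    have a: "0 < a" and t: "0 < t" using elim by (auto simp: a_def t_def)
    \<comment> \<open>after scaling by \<open>a\<close>, the tangent to \<open>t powr (- 2 * s)\<close> at \<open>t = 1\<close>\<close>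
    have "1 - 2 * s * (t - 1) \<le> 1 + (- 2 * s) * ln t"
      using s t ln_le_minus_one[of t] by simp
    also have "\<dots> \<le> t powr (- 2 * s)"
      using t exp_ge_add_one_self[of "(- 2 * s) * ln t"] by (simp add: powr_def)
    finally have "a powr (- 2 * s) * (1 + 2 * s) \<le> a powr (- 2 * s) * (t powr (- 2 * s) + 2 * s * t)"
      by (intro mult_left_mono) (auto simp: algebra_simps)
    moreover have "a powr (- 2 * s) * t powr (- 2 * s) = \<omega> x powr (- s)"
    proof -
      have "a powr (- 2 * s) * t powr (- 2 * s) = sqrt (\<omega> x) powr (- 2 * s)"
        using a t powr_mult[of a t "- 2 * s"] by (simp add: t_def)
      then show ?thesis
        using elim by (simp add: powr_powr flip: powr_half_sqrt)
    qed
    moreover have "a powr (- 2 * s) * (2 * s * t) = c x * sqrt (\<omega> x)"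
      using a powr_diff[of a "- 2 * s" 1] by (simp add: c_def t_def a_def)
    ultimately have "(1 + 2 * s) * a powr (- 2 * s) \<le> \<omega> x powr (- s) + c x * sqrt (\<omega> x)"
      by (simp only: distrib_left mult.commute)
    then show ?case
      using elim c_nonneg by (simp add: u_def a_def flip: ennreal_mult ennreal_plus)
  qed
  then have "AE x in M. nn_cond_exp M G u x
      \<le> nn_cond_exp M G (\<lambda>x. 1 * ennreal (\<omega> x powr (- s)) + ennreal (c x) * ennreal (sqrt (\<omega> x))) x"
    by (rule nn_cond_exp_mono) measurable
  moreover have "AE x in M.
      nn_cond_exp M G (\<lambda>x. 1 * ennreal (\<omega> x powr (- s)) + ennreal (c x) * ennreal (sqrt (\<omega> x))) x
      = 1 * nn_cond_exp M G (\<lambda>x. ennreal (\<omega> x powr (- s))) x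
        + ennreal (c x) * nn_cond_exp M G (\<lambda>x. ennreal (sqrt (\<omega> x))) x"
    by (rule nn_cond_exp_lincomb) measurable
  moreover have "AE x in M. u x = nn_cond_exp M G u x"
    by (rule nn_cond_exp_F_meas) measurable
  ultimately show ?thesis
    using Ap mean_pos sqrt_mean_pos sqrt_mean_eq
  proof eventually_elim
    case (elim x)
    let ?v = "mean x" and ?a = "sqrt_mean x"
    let ?B = "nn_cond_exp M G (\<lambda>x. ennreal (\<omega> x powr (- s))) x"
    have AC: "ennreal ?v * ennreal_powr ?B (p - 1) \<le> ennreal C"
      using elim(4) s(3) by simp
    \<comment> \<open>as \<open>?v > 0\<close>, an infinite \<open>?B\<close> would make the left-hand side infinite\<close>
    then have "?B \<noteq> \<top>"
      using elim(5) by (auto simp: ennreal_powr_def ennreal_mult_top top_unique)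
    then obtain b where b: "?B = ennreal b" "0 \<le> b"
      by (cases ?B) auto
    have "(1 + 2 * s) * ?a powr (- 2 * s) \<le> b + c x * ?a"
    proof -
      have "u x \<le> ennreal b + ennreal (c x) * ennreal ?a"
        using elim(1-3,7) b by simp
      then show ?thesis
        using elim(6) b c_nonneg[of x] by (simp add: u_def flip: ennreal_mult ennreal_plus)
    qed
    also have "c x * ?a = 2 * s * ?a powr (- 2 * s)"
      using elim(6) powr_add[of ?a "- 2 * s - 1" 1] by (simp add: c_def)
    finally have "?a powr (- 2 * s) \<le> b"
      by (simp add: algebra_simps)
    then have "(?a powr (- 2 * s)) powr (p - 1) \<le> b powr (p - 1)"
      using \<open>1 < p\<close> by (intro powr_mono2) auto
    also have "(?a powr (- 2 * s)) powr (p - 1) = ?a powr (-2)"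
      using s(2) by (simp add: powr_powr mult.assoc)
    also have "\<dots> = 1 / ?a\<^sup>2"
      using elim(6) by (simp add: powr_minus_divide)
    finally have "?v * (1 / ?a\<^sup>2) \<le> ?v * b powr (p - 1)"
      using elim(5) by (intro mult_left_mono) auto
    also have "\<dots> \<le> C"
      using AC b elim(5) \<open>1 < C\<close> by (simp add: ennreal_powr_def flip: ennreal_mult)
    finally show ?case
      using elim(6) by (simp add: field_simps)
  qed
qed

text \<open>
  This is Jensen's inequality for the logarithm, \<open>E(log \<omega>) = 2 E(log \<surd>\<omega>) \<le> 2 log a\<close> with
  \<open>a = sqrt_mean\<close>, obtained from the tangent bound \<open>log \<omega> \<le> 2 log a + 2 \<surd>\<omega> / a - 2\<close>.  The
  positive and negative parts of \<open>log \<omega>\<close> and of \<open>log a\<close> are placed on the sides where they are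
  nonnegative.  \<open>E(log\<^sup>- \<omega>)\<close> may be infinite, and then the left-hand side of the claim is \<open>0\<close>.
\<close>

lemma ereal_exp_cond_exp_ln_le:
  "AE x in M. ereal_exp (ereal_cond_exp M G (\<lambda>y. ln (\<omega> y)) x) \<le> ennreal ((sqrt_mean x)\<^sup>2)"
proof -
  let ?E = "nn_cond_exp M G"
  let ?P = "\<lambda>x. ennreal (ln (\<omega> x))" and ?N = "\<lambda>x. ennreal (- ln (\<omega> x))"
  define u where "u = (\<lambda>x. 2 + 2 * max 0 (- ln (sqrt_mean x)))"
  define v where "v = (\<lambda>x. 2 * max 0 (ln (sqrt_mean x)))"
  define c where "c = (\<lambda>x. 2 / sqrt_mean x)"
  have nonneg: "0 \<le> u x" "0 \<le> v x" for x
    by (auto simp: u_def v_def)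
  have [measurable]: "u \<in> borel_measurable G" "v \<in> borel_measurable G" "c \<in> borel_measurable G"
    "u \<in> borel_measurable M" "v \<in> borel_measurable M" "c \<in> borel_measurable M"
    unfolding u_def v_def c_def by measurable
  have tangent: "AE x in M. ?P x + ennreal (u x)
      \<le> (?N x + ennreal (v x)) + ennreal (c x) * ennreal (sqrt (\<omega> x))"
    using weight_pos sqrt_mean_pos
  proof eventually_elim
    case (elim x)
    have "ln (\<omega> x) = 2 * ln (sqrt (\<omega> x))"
      using elim by (simp add: ln_sqrt)
    also have "\<dots> = 2 * (ln (sqrt_mean x) + ln (sqrt (\<omega> x) / sqrt_mean x))"
      using elim by (simp add: ln_div)
    also have "\<dots> \<le> 2 * (ln (sqrt_mean x) + (sqrt (\<omega> x) / sqrt_mean x - 1))"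
      using elim by (intro mult_left_mono add_left_mono ln_le_minus_one) auto
    finally have "max 0 (ln (\<omega> x)) + u x \<le> (max 0 (- ln (\<omega> x)) + v x) + c x * sqrt (\<omega> x)"
      by (simp add: u_def v_def c_def)
    moreover have "0 \<le> c x" using elim by (simp add: c_def)
    ultimately have "ennreal (max 0 (ln (\<omega> x)) + u x)
        \<le> ennreal ((max 0 (- ln (\<omega> x)) + v x) + c x * sqrt (\<omega> x))"
      by (intro ennreal_leI)
    with \<open>0 \<le> c x\<close> show ?case
      using elim(1) nonneg by (simp add: ennreal_mult)
  qed
  have 1: "AE x in M. ?E (\<lambda>x. ?P x + ennreal (u x)) x
      \<le> ?E (\<lambda>x. 1 * (?N x + ennreal (v x)) + ennreal (c x) * ennreal (sqrt (\<omega> x))) x"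
    using tangent by (intro nn_cond_exp_mono) auto
  have 2: "AE x in M. ?E ?P x + ?E (\<lambda>x. ennreal (u x)) x = ?E (\<lambda>x. ?P x + ennreal (u x)) x"
    by (rule nn_cond_exp_sum) measurable
  have 3: "AE x in M. ?E (\<lambda>x. 1 * (?N x + ennreal (v x)) + ennreal (c x) * ennreal (sqrt (\<omega> x))) x
      = 1 * ?E (\<lambda>x. ?N x + ennreal (v x)) x + ennreal (c x) * ?E (\<lambda>x. ennreal (sqrt (\<omega> x))) x"
    by (rule nn_cond_exp_lincomb) measurable
  have 4: "AE x in M. ?E ?N x + ?E (\<lambda>x. ennreal (v x)) x = ?E (\<lambda>x. ?N x + ennreal (v x)) x"
    by (rule nn_cond_exp_sum) measurable
  have 5: "AE x in M. ennreal (u x) = ?E (\<lambda>x. ennreal (u x)) x"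
    "AE x in M. ennreal (v x) = ?E (\<lambda>x. ennreal (v x)) x"
    by (rule nn_cond_exp_F_meas; measurable)+
  \<comment> \<open>\<open>log\<^sup>+ \<omega> \<le> \<omega>\<close>, so only the negative part can have an infinite conditional expectation\<close>
  have 6: "AE x in M. ?E ?P x \<le> ?E (\<lambda>x. ennreal (\<omega> x)) x"
    using weight_pos by (intro nn_cond_exp_mono) (auto intro!: ennreal_leI ln_bound)
  show ?thesis
    using 1 2 3 4 5 6 mean_eq sqrt_mean_eq sqrt_mean_pos
  proof eventually_elim
    case (elim x)
    let ?a = "sqrt_mean x"
    have "?E ?P x \<noteq> \<top>"
      using elim(7,8) by (metis ennreal_neq_top top_unique)
    then obtain P where P: "?E ?P x = ennreal P" "0 \<le> P" by (cases "?E ?P x") auto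
    show ?case
    proof (cases "?E ?N x")
      case top
      then show ?thesis by (simp add: ereal_cond_exp_def ereal_exp_def P)
    next
      case (real N)
      have c: "0 \<le> c x" "c x * ?a = 2" using elim(10) by (simp_all add: c_def)
      have "ennreal P + ennreal (u x) \<le> (ennreal N + ennreal (v x)) + ennreal (c x) * ennreal ?a"
        using elim(1-6,9) P real by simp
      then have "P + u x \<le> N + v x + c x * ?a"
        using P(2) real(1) nonneg c(1) elim(10) by (simp flip: ennreal_mult ennreal_plus)
      then have "P - N \<le> 2 * ln ?a"
        unfolding c(2) by (auto simp: u_def v_def max_def split: if_splits)
      then have "exp (P - N) \<le> exp (ln ?a) ^ 2"
        by (simp flip: exp_double)
      then show ?thesis
        using elim(10) P real
        by (simp add: ereal_cond_exp_def ereal_exp_def ennreal_leI enn2ereal_ennreal)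
    qed
  qed
qed

end

section \<open>From the reverse Jensen inequality to the maximal function\<close>

text \<open>
  Taking the supremum over \<open>m \<ge> n\<close> in the hypothesis bounds \<open>tailed_max\<close> by \<open>C\<close> times the squared
  maximal function of the martingale generated by \<open>\<surd>\<omega>\<close>, and Doob's inequality for the shifted filtration
  \<open>F (n + i)\<close> compares the latter with \<open>(\<surd>\<omega>)\<^sup>2 = \<omega>\<close>.  The exponent \<open>1/2\<close> is chosen for this:
  it makes the maximal inequality the elementary one of \<open>L\<^sup>2\<close>.
\<close>

lemma A_inf_star_if_mean_le_sqrt_mean_square:
  assumes "filtered_prob_space M F" and weight: "weight M \<omega>" and "0 < C"
    and mean_le: "\<And>n. AE x in M. real_cond_exp M (F n) \<omega> x
      \<le> C * (real_cond_exp M (F n) (\<lambda>y. sqrt (\<omega> y)) x)\<^sup>2"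
  shows "\<omega> \<in> A_inf_star M F"
proof -
  have "prob_space M" and filt: "filtration (space M) F" and sub: "\<And>n. subalgebra M (F n)"
    using assms(1) by (auto simp: filtered_prob_space_def)
  interpret prob_space M by fact
  interpret W: weighted_subalgebra M "F n" \<omega> for n
    by unfold_locales (fact sub weight)+
  have nested: "subalgebra (F j) (F i)" if "i \<le> j" for i j
    using filtration.sets_F_mono[OF filt that] filtration.space_F[OF filt]
    by (simp add: subalgebra_def)
  define g where "g = (\<lambda>x. ennreal (sqrt (\<omega> x)))"
  note [measurable] = W.weight_measurable
  have [measurable]: "g \<in> borel_measurable M"
    unfolding g_def by measurable
  have all_mean_le: "AE x in M. \<forall>m. ennreal \<bar>real_cond_exp M (F m) \<omega> x\<bar>
      \<le> ennreal C * (nn_cond_exp M (F m) g x)\<^sup>2"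
    unfolding AE_all_countable
  proof
    fix m
    show "AE x in M. ennreal \<bar>real_cond_exp M (F m) \<omega> x\<bar>
      \<le> ennreal C * (nn_cond_exp M (F m) g x)\<^sup>2"
      using mean_le[of m] W.mean_pos[of m] W.sqrt_mean_pos[of m] W.sqrt_mean_eq[of m]
    proof eventually_elim
      case (elim x)
      have "ennreal \<bar>real_cond_exp M (F m) \<omega> x\<bar>
          \<le> ennreal (C * (real_cond_exp M (F m) (\<lambda>y. sqrt (\<omega> y)) x)\<^sup>2)"
        using elim(1,2) by (intro ennreal_leI) simp
      also have "\<dots> = ennreal C * (nn_cond_exp M (F m) g x)\<^sup>2"
        using elim(3) \<open>0 < C\<close> unfolding g_def elim(4)[symmetric]
        by (simp add: ennreal_mult ennreal_power)
      finally show ?case .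
    qed
  qed
  have "AE x in M. nn_cond_exp M (F n) (tailed_max M F n \<omega>) x
      \<le> ennreal (4 * C * real_cond_exp M (F n) \<omega> x)" for n
  proof -
    define S where "S = (\<lambda>x. (SUP i. nn_cond_exp M (F (n + i)) g x)\<^sup>2)"
    have [measurable]: "S \<in> borel_measurable M"
      unfolding S_def by measurable
    have [measurable]: "tailed_max M F n \<omega> \<in> borel_measurable M"
      unfolding tailed_max_def by measurable
    have "AE x in M. tailed_max M F n \<omega> x \<le> ennreal C * S x"
      using all_mean_le
    proof eventually_elim
      case (elim x)
      have "(nn_cond_exp M (F m) g x)\<^sup>2 \<le> S x" if "n \<le> m" for m
        unfolding S_def
        by (intro power_mono SUP_upper2[of "m - n"]) (use that in simp_all)
      then have "ennreal C * (nn_cond_exp M (F m) g x)\<^sup>2 \<le> ennreal C * S x" if "n \<le> m" for m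
        using that by (intro mult_left_mono) auto
      with elim show ?case
        unfolding tailed_max_def by (intro SUP_least) (auto intro: order_trans)
    qed
    then have "AE x in M. nn_cond_exp M (F n) (tailed_max M F n \<omega>) x
        \<le> nn_cond_exp M (F n) (\<lambda>x. ennreal C * S x) x"
      by (rule W.nn_cond_exp_mono) measurable
    moreover have "AE x in M. ennreal C * nn_cond_exp M (F n) S x
        = nn_cond_exp M (F n) (\<lambda>x. ennreal C * S x) x"
      by (rule W.nn_cond_exp_prod) measurable
    moreover have "AE x in M. nn_cond_exp M (F n) S x \<le> 4 * nn_cond_exp M (F n) (\<lambda>x. (g x)\<^sup>2) x"
      using conditional_Doob_L2[where F = "\<lambda>i. F (n + i)" and g = g and M = M] nested sub
      unfolding S_def by (simp add: finite_measure_axioms)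
    moreover have "AE x in M. nn_cond_exp M (F n) (\<lambda>x. (g x)\<^sup>2) x
        = nn_cond_exp M (F n) (\<lambda>x. ennreal (\<omega> x)) x"
    proof (rule W.nn_cond_exp_cong)
      show "AE x in M. (g x)\<^sup>2 = ennreal (\<omega> x)"
        using W.weight_pos by eventually_elim (simp add: g_def ennreal_power)
    qed measurable
    ultimately show ?thesis
      using W.mean_eq[of n] W.mean_pos[of n]
    proof eventually_elim
      case (elim x)
      have "nn_cond_exp M (F n) (tailed_max M F n \<omega>) x
          \<le> ennreal C * nn_cond_exp M (F n) S x"
        using elim(1,2) by simp
      also have "\<dots> \<le> ennreal C * (4 * ennreal (real_cond_exp M (F n) \<omega> x))"
        using elim(3) unfolding elim(4,5) by (rule mult_left_mono) simp
      also have "\<dots> = ennreal (4 * C * real_cond_exp M (F n) \<omega> x)"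
        using \<open>0 < C\<close> elim(6) by (simp add: ennreal_mult mult_ac)
      finally show ?case .
    qed
  qed
  moreover have "0 < 4 * C" using \<open>0 < C\<close> by simp
  ultimately show ?thesis
    unfolding A_inf_star_def by blast
qed

theorem theorem1p8:
  fixes M :: "'a measure" and F :: "nat \<Rightarrow> 'a measure" and \<omega> :: "'a \<Rightarrow> real"
  assumes "filtered_prob_space M F"
    and "weight M \<omega>"
  shows "(\<omega> \<in> (\<Union>p\<in>{1<..}. A_p M F p) \<longrightarrow> \<omega> \<in> A_inf_star M F) \<and>
         (\<omega> \<in> (\<Union>q\<in>{1<..}. RH_q M F q) \<longrightarrow> \<omega> \<in> A_inf_star M F) \<and>
         (\<omega> \<in> A_inf_log M F \<longrightarrow> \<omega> \<in> A_inf_star M F) \<and>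
         (\<omega> \<in> A_inf_exp M F \<longrightarrow> \<omega> \<in> A_inf_star M F)"
proof -
  have "prob_space M" and sub: "\<And>n. subalgebra M (F n)"
    using assms(1) by (auto simp: filtered_prob_space_def)
  interpret prob_space M by fact
  interpret W: weighted_subalgebra M "F n" \<omega> for n
    by unfold_locales (fact sub assms(2))+
  note criterion = A_inf_star_if_mean_le_sqrt_mean_square[OF assms]
  have "\<omega> \<in> A_inf_star M F" if p: "1 < p" and mem: "\<omega> \<in> A_p M F p" for p
  proof -
    obtain C where C: "1 < C"
      and "\<And>n. AE x in M. ennreal (real_cond_exp M (F n) \<omega> x)
        * ennreal_powr (nn_cond_exp M (F n) (\<lambda>y. ennreal (\<omega> y powr (- 1 / (p - 1)))) x) (p - 1)
        \<le> ennreal C"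
      using mem unfolding A_p_def by blast
    from W.mean_le_of_Muckenhoupt[OF C p this(2)] C show ?thesis
      by (intro criterion[of C]) auto
  qed
  moreover have "\<omega> \<in> A_inf_star M F" if q: "1 < q" and mem: "\<omega> \<in> RH_q M F q" for q
  proof -
    obtain C where C: "1 < C"
      and "\<And>n. AE x in M. nn_cond_exp M (F n) (\<lambda>y. ennreal (\<omega> y powr q)) x
        \<le> ennreal (C * real_cond_exp M (F n) \<omega> x powr q)"
      using mem unfolding RH_q_def by blast
    from W.mean_le_of_reverse_Hoelder[OF C q this(2)] C show ?thesis
      by (intro criterion[of "4 * (2 * C) powr (1 / (q - 1))"]) auto
  qed
  moreover have "\<omega> \<in> A_inf_star M F" if mem: "\<omega> \<in> A_inf_log M F"
  proof -
    obtain C where C: "1 < C"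
      and "\<And>n. AE x in M. weighted_cond_exp M (F n) \<omega>
          (\<lambda>y. ennreal (log_plus (\<omega> y / real_cond_exp M (F n) \<omega> y))) x \<le> ennreal C"
      using mem unfolding A_inf_log_def by blast
    from W.mean_le_of_log_bound[OF C this(2)] show ?thesis
      by (intro criterion[of "4 * exp (2 * C)"]) auto
  qed
  moreover have "\<omega> \<in> A_inf_star M F" if mem: "\<omega> \<in> A_inf_exp M F"
  proof -
    obtain C where C: "0 < C"
      and exp: "\<And>n. AE x in M. ennreal (real_cond_exp M (F n) \<omega> x)
        \<le> ennreal C * ereal_exp (ereal_cond_exp M (F n) (\<lambda>y. ln (\<omega> y)) x)"
      using mem unfolding A_inf_exp_def by blast
    show ?thesis
    proof (rule criterion[OF C])
      fix n
      show "AE x in M. real_cond_exp M (F n) \<omega> x \<le> C * (real_cond_exp M (F n) (\<lambda>y. sqrt (\<omega> y)) x)\<^sup>2"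
        using exp[of n] W.ereal_exp_cond_exp_ln_le[of n]
      proof eventually_elim
        case (elim x)
        note elim(1)
        also have "ennreal C * ereal_exp (ereal_cond_exp M (F n) (\<lambda>y. ln (\<omega> y)) x)
            \<le> ennreal C * ennreal ((real_cond_exp M (F n) (\<lambda>y. sqrt (\<omega> y)) x)\<^sup>2)"
          using elim(2) by (rule mult_left_mono) simp
        also have "\<dots> = ennreal (C * (real_cond_exp M (F n) (\<lambda>y. sqrt (\<omega> y)) x)\<^sup>2)"
          using C by (simp add: ennreal_mult)
        finally show ?case
          using C by (simp add: ennreal_le_iff)
      qed
    qed
  qed
  ultimately show ?thesis by auto
qed

end
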